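(* For every positive integer $n$, each of the following statistics on $S_n$ is homomesic with respect to the reverse map $\mathcal{R}$, while, for each of them, there is some $n$ for which it is not homomesic on $S_n$ with respect to the complement map $\mathcal{C}$: (1) the load of $\sigma$, defined as $\mathrm{maj}(\mathcal{R}(\sigma^{-1}))$; (2) the inverse major index $\mathrm{maj}(\sigma^{-1})$; (3) the disorder of $\sigma$; (4) the inversion index of $\sigma$; (5) the makl of $\sigma$.
   Context: Homomesy: given a finite set $S$, a bijection $\mathcal{X}:S\to S$ and $f:S\to\mathbb{Z}$, $f$ is homomesic if there is a constant $c$ such that for every orbit $\mathcal{O}$ of $\mathcal{X}$, $\frac{1}{|\mathcal{O}|}\sum_{x\in\mathcal{O}}f(x)=c$. For $\sigma\in S_n$ in one-line notation: $\mathcal{R}(\sigma)_i=\sigma_{n+1-i}$, $\mathcal{C}(\sigma)_i=n+1-\sigma_i$. $\mathrm{maj}(\pi)$ is the sum of the indices $i\in[n-1]$ with $\pi_i>\pi_{i+1}$. The disorder: pass cyclically through $\sigma$ from left to right, removing the values $1,2,\dots,n$ in that order (each pass removes the next needed values as they are encountered); the disorder is the total, over all positions, of the number of passes in which that position is not removed (e.g. for $12543$ it equals $3$). The inversion index is $\sum \sigma_i$ over all pairs $i<j$ with $\sigma_i>\sigma_j$. An occurrence of a vincular pattern $a\text{-}bc$ (resp. $ab\text{-}c$) is a triple of positions $i_1<i_2<i_3$ with $\sigma_{i_1}\sigma_{i_2}\sigma_{i_3}$ in the same relative order as $abc$ and $i_3=i_2+1$ (resp. $i_2=i_1+1$). The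 makl is the total number of occurrences of $1\text{-}32$, $31\text{-}2$, $32\text{-}1$ plus the number of descents (occurrences of the consecutive pattern $21$). *)

theory Defs
  imports Complex_Main "HOL-Combinatorics.Orbits"
begin

text \<open>
  Homomesy of a statistic \<open>f\<close> on a finite set \<open>S\<close> under a bijection \<open>X\<close> of \<open>S\<close>.
  For such \<open>S\<close> and \<open>X\<close>, the orbits are exactly the sets \<open>orbit X x\<close> with \<open>x \<in> S\<close>.
  Finiteness and bijectivity are preconditions, not part of the predicate, so that a negated
  instance does say that the averages differ; they are proved below for the two maps considered.
\<close>
definition homomesic :: "'a set \<Rightarrow> ('a \<Rightarrow> 'a) \<Rightarrow> ('a \<Rightarrow> int) \<Rightarrow> bool" where
  "homomesic S X f \<longleftrightarrow>
    (\<exists>c::real. \<forall>x\<in>S. (1 / real (card (orbit X x))) * (\<Sum>y\<in>orbit X x. real_of_int (f y)) = c)"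

text \<open>
  \<open>Sym n\<close> is the symmetric group on \<open>{1..n}\<close>; the one-line notation of \<open>\<sigma>\<close> is
  \<open>\<sigma> 1, \<dots>, \<sigma> n\<close>, and elements are the identity outside \<open>{1..n}\<close>.
\<close>
definition Sym :: "nat \<Rightarrow> (nat \<Rightarrow> nat) set" where
  "Sym n = {\<sigma>. \<sigma> permutes {1..n}}"

definition reverse_map :: "nat \<Rightarrow> (nat \<Rightarrow> nat) \<Rightarrow> (nat \<Rightarrow> nat)" where
  "reverse_map n \<sigma> = (\<lambda>i. if i \<in> {1..n} then \<sigma> (n + 1 - i) else i)"

definition complement_map :: "nat \<Rightarrow> (nat \<Rightarrow> nat) \<Rightarrow> (nat \<Rightarrow> nat)" where
  "complement_map n \<sigma> = (\<lambda>i. if i \<in> {1..n} then n + 1 - \<sigma> i else i)"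

definition maj :: "nat \<Rightarrow> (nat \<Rightarrow> nat) \<Rightarrow> nat" where
  "maj n \<pi> = (\<Sum>i | i \<in> {1..<n} \<and> \<pi> i > \<pi> (i + 1). i)"

definition load :: "nat \<Rightarrow> (nat \<Rightarrow> nat) \<Rightarrow> int" where
  "load n \<sigma> = int (maj n (reverse_map n (inv \<sigma>)))"

definition inverse_maj :: "nat \<Rightarrow> (nat \<Rightarrow> nat) \<Rightarrow> int" where
  "inverse_maj n \<sigma> = int (maj n (inv \<sigma>))"

text \<open>
  One pass from left to right through a list of positions of \<open>\<sigma>\<close>, where \<open>k\<close> is the next value
  to be removed: returns the next value needed after the pass and the positions not removed.
\<close>
fun pass :: "(nat \<Rightarrow> nat) \<Rightarrow> nat \<Rightarrow> nat list \<Rightarrow> nat \<times> nat list" where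
  "pass \<sigma> k [] = (k, [])"
| "pass \<sigma> k (i # is) =
    (if \<sigma> i = k then pass \<sigma> (k + 1) is
     else (let (k', js) = pass \<sigma> k is in (k', i # js)))"

primrec passes :: "nat \<Rightarrow> (nat \<Rightarrow> nat) \<Rightarrow> nat \<Rightarrow> nat \<times> nat list" where
  "passes n \<sigma> 0 = (1, [1..<n + 1])"
| "passes n \<sigma> (Suc t) = (let (k, is) = passes n \<sigma> t in pass \<sigma> k is)"

text \<open>
  Position \<open>i\<close> is encountered but not removed in the \<open>t\<close>-th pass (\<open>t \<ge> 1\<close>) iff it is
  still present after that pass.  The set of such \<open>t\<close> is finite by \<open>passes_finished\<close> below.
\<close>
definition disorder :: "nat \<Rightarrow> (nat \<Rightarrow> nat) \<Rightarrow> int" where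
  "disorder n \<sigma> = int (\<Sum>i\<in>{1..n}. card {t. t \<ge> 1 \<and> i \<in> set (snd (passes n \<sigma> t))})"

definition inversion_index :: "nat \<Rightarrow> (nat \<Rightarrow> nat) \<Rightarrow> int" where
  "inversion_index n \<sigma> =
    int (\<Sum>(i, j) | i \<in> {1..n} \<and> j \<in> {1..n} \<and> i < j \<and> \<sigma> i > \<sigma> j. \<sigma> i)"

definition same_relative_order :: "nat list \<Rightarrow> nat list \<Rightarrow> bool" where
  "same_relative_order xs ys \<longleftrightarrow> length xs = length ys \<and>
    (\<forall>i < length xs. \<forall>j < length xs. xs ! i < xs ! j \<longleftrightarrow> ys ! i < ys ! j)"

text \<open>Occurrences of the vincular pattern \<open>a-bc\<close>.\<close>
definition occ_1_23 :: "nat \<Rightarrow> (nat \<Rightarrow> nat) \<Rightarrow> nat \<Rightarrow> nat \<Rightarrow> nat \<Rightarrow> (nat \<times> nat \<times> nat) set" where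
  "occ_1_23 n \<sigma> a b c =
    {(i\<^sub>1, i\<^sub>2, i\<^sub>3). 1 \<le> i\<^sub>1 \<and> i\<^sub>1 < i\<^sub>2 \<and> i\<^sub>2 < i\<^sub>3 \<and> i\<^sub>3 \<le> n \<and> i\<^sub>3 = i\<^sub>2 + 1 \<and>
      same_relative_order [\<sigma> i\<^sub>1, \<sigma> i\<^sub>2, \<sigma> i\<^sub>3] [a, b, c]}"

text \<open>Occurrences of the vincular pattern \<open>ab-c\<close>.\<close>
definition occ_12_3 :: "nat \<Rightarrow> (nat \<Rightarrow> nat) \<Rightarrow> nat \<Rightarrow> nat \<Rightarrow> nat \<Rightarrow> (nat \<times> nat \<times> nat) set" where
  "occ_12_3 n \<sigma> a b c =
    {(i\<^sub>1, i\<^sub>2, i\<^sub>3). 1 \<le> i\<^sub>1 \<and> i\<^sub>1 < i\<^sub>2 \<and> i\<^sub>2 < i\<^sub>3 \<and> i\<^sub>3 \<le> n \<and> i\<^sub>2 = i\<^sub>1 + 1 \<and>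
      same_relative_order [\<sigma> i\<^sub>1, \<sigma> i\<^sub>2, \<sigma> i\<^sub>3] [a, b, c]}"

definition descents :: "nat \<Rightarrow> (nat \<Rightarrow> nat) \<Rightarrow> nat set" where
  "descents n \<sigma> = {i \<in> {1..<n}. \<sigma> i > \<sigma> (i + 1)}"

definition makl :: "nat \<Rightarrow> (nat \<Rightarrow> nat) \<Rightarrow> int" where
  "makl n \<sigma> = int (card (occ_1_23 n \<sigma> 1 3 2) + card (occ_12_3 n \<sigma> 3 1 2)
    + card (occ_12_3 n \<sigma> 3 2 1) + card (descents n \<sigma>))"

lemma finite_Sym: "finite (Sym n)"
  by (simp add: Sym_def finite_permutations)

lemma reverse_map_in_Sym:
  assumes "\<sigma> \<in> Sym n" shows "reverse_map n \<sigma> \<in> Sym n"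
proof -
  define r where "r = (\<lambda>i. if i \<in> {1..n} then n + 1 - i else i)"
  have "bij_betw r {1..n} {1..n}"
    by (rule bij_betw_byWitness[where f' = r]) (auto simp: r_def)
  hence "r permutes {1..n}"
    by (rule bij_imp_permutes) (auto simp: r_def)
  with assms have "\<sigma> \<circ> r permutes {1..n}"
    by (auto simp: Sym_def intro: permutes_compose)
  moreover have "\<sigma> \<circ> r = reverse_map n \<sigma>"
    using assms by (auto simp: Sym_def reverse_map_def r_def fun_eq_iff permutes_def)
  ultimately show ?thesis by (simp add: Sym_def)
qed

lemma complement_map_in_Sym:
  assumes "\<sigma> \<in> Sym n" shows "complement_map n \<sigma> \<in> Sym n"
proof -
  define r where "r = (\<lambda>i. if i \<in> {1..n} then n + 1 - i else i)"
  have "bij_betw r {1..n} {1..n}"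
    by (rule bij_betw_byWitness[where f' = r]) (auto simp: r_def)
  hence "r permutes {1..n}"
    by (rule bij_imp_permutes) (auto simp: r_def)
  with assms have "r \<circ> \<sigma> permutes {1..n}"
    by (auto simp: Sym_def intro: permutes_compose)
  moreover have "(r \<circ> \<sigma>) i = complement_map n \<sigma> i" for i
  proof (cases "i \<in> {1..n}")
    case True
    with assms have "\<sigma> i \<in> {1..n}" by (simp add: Sym_def permutes_in_image del: atLeastAtMost_iff)
    with True show ?thesis by (simp add: complement_map_def r_def)
  next
    case False
    with assms have "\<sigma> i = i" by (auto simp: Sym_def permutes_not_in)
    with False show ?thesis by (auto simp: complement_map_def r_def)
  qed
  hence "r \<circ> \<sigma> = complement_map n \<sigma>" by auto
  ultimately show ?thesis by (simp add: Sym_def)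
qed

lemma bij_betw_reverse_map: "bij_betw (reverse_map n) (Sym n) (Sym n)"
proof (rule bij_betw_byWitness[where f' = "reverse_map n"])
  have "reverse_map n (reverse_map n \<sigma>) = \<sigma>" if "\<sigma> \<in> Sym n" for \<sigma>
    using that by (auto simp: Sym_def reverse_map_def fun_eq_iff permutes_def)
  then show "\<forall>\<sigma>\<in>Sym n. reverse_map n (reverse_map n \<sigma>) = \<sigma>"
    "\<forall>\<sigma>\<in>Sym n. reverse_map n (reverse_map n \<sigma>) = \<sigma>" by auto
qed (auto intro: reverse_map_in_Sym)

lemma bij_betw_complement_map: "bij_betw (complement_map n) (Sym n) (Sym n)"
proof (rule bij_betw_byWitness[where f' = "complement_map n"])
  have "complement_map n (complement_map n \<sigma>) i = \<sigma> i" if "\<sigma> \<in> Sym n" for \<sigma> i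
  proof (cases "i \<in> {1..n}")
    case True
    with that have "\<sigma> i \<in> {1..n}" by (simp add: Sym_def permutes_in_image del: atLeastAtMost_iff)
    with True show ?thesis by (simp add: complement_map_def)
  next
    case False
    with that have "\<sigma> i = i" by (auto simp: Sym_def permutes_not_in)
    with False show ?thesis by (auto simp: complement_map_def)
  qed
  then show "\<forall>\<sigma>\<in>Sym n. complement_map n (complement_map n \<sigma>) = \<sigma>"
    "\<forall>\<sigma>\<in>Sym n. complement_map n (complement_map n \<sigma>) = \<sigma>" by auto
qed (auto intro: complement_map_in_Sym)

lemma pass_fst_ge: "k \<le> fst (pass \<sigma> k is)"
proof (induction "is" arbitrary: k)
  case (Cons i "is")
  from Cons[of k] Cons[of "k + 1"] show ?case by (auto simp: split_beta)
qed simp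

lemma pass_fst_le:
  "k \<le> v \<Longrightarrow> v \<notin> \<sigma> ` set is \<Longrightarrow> fst (pass \<sigma> k is) \<le> v"
proof (induction "is" arbitrary: k)
  case (Cons i "is")
  from Cons.IH[of k] Cons.IH[of "k + 1"] Cons.prems show ?case by (auto simp: split_beta)
qed simp

lemma pass_fst_gt:
  "k \<in> \<sigma> ` set is \<Longrightarrow> k < fst (pass \<sigma> k is)"
proof (induction "is" arbitrary: k)
  case (Cons i "is")
  from Cons.IH[of k] Cons.prems pass_fst_ge[of "k + 1" \<sigma> "is"] show ?case
    by (auto simp: split_beta)
qed simp

lemma pass_snd:
  "inj \<sigma> \<Longrightarrow> distinct is \<Longrightarrow> \<forall>i\<in>set is. k \<le> \<sigma> i \<Longrightarrow>
    snd (pass \<sigma> k is) = filter (\<lambda>i. fst (pass \<sigma> k is) \<le> \<sigma> i) is"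
proof (induction "is" arbitrary: k)
  case (Cons i "is")
  have notin: "\<sigma> i \<notin> \<sigma> ` set is" using Cons.prems by (auto dest: injD)
  show ?case
  proof (cases "\<sigma> i = k")
    case True
    have "\<forall>j\<in>set is. k + 1 \<le> \<sigma> j"
    proof
      fix j assume "j \<in> set is"
      then have "k \<le> \<sigma> j" "\<sigma> j \<noteq> k" using Cons.prems notin True by (auto, metis imageI)
      then show "k + 1 \<le> \<sigma> j" by simp
    qed
    with Cons.IH[of "k + 1"] Cons.prems
    have "snd (pass \<sigma> (k + 1) is) = filter (\<lambda>i. fst (pass \<sigma> (k + 1) is) \<le> \<sigma> i) is" by simp
    with True pass_fst_ge[of "k + 1" \<sigma> "is"] show ?thesis by simp
  next
    case False
    with Cons.prems have "fst (pass \<sigma> k is) \<le> \<sigma> i"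
      by (intro pass_fst_le[OF _ notin]) simp
    with False Cons.IH[of k] Cons.prems show ?thesis by (simp add: split_beta)
  qed
qed simp

lemma passes_invariant:
  assumes "\<sigma> \<in> Sym n"
  shows "snd (passes n \<sigma> t) = filter (\<lambda>i. fst (passes n \<sigma> t) \<le> \<sigma> i) [1..<n + 1]
    \<and> min (Suc t) (Suc n) \<le> fst (passes n \<sigma> t)"
proof -
  have p: "\<sigma> permutes {1..n}" using assms by (simp add: Sym_def)
  have "inj \<sigma>" by (rule permutes_inj[OF p])
  show ?thesis
  proof (induction t)
    case 0
    have "1 \<le> \<sigma> i" if "i \<in> {1..n}" for i
      using permutes_in_image[OF p, of i] that by simp
    then show ?case by (auto intro!: filter_True[symmetric] simp del: upt_Suc simp: Suc_le_eq)
  next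
    case (Suc t)
    obtain k js where e: "passes n \<sigma> t = (k, js)" by fastforce
    with Suc have js: "js = filter (\<lambda>i. k \<le> \<sigma> i) [1..<n + 1]" and k: "min (Suc t) (Suc n) \<le> k"
      by auto
    have s: "snd (pass \<sigma> k js) = filter (\<lambda>i. fst (pass \<sigma> k js) \<le> \<sigma> i) js"
      using \<open>inj \<sigma>\<close> by (rule pass_snd) (simp_all add: js del: upt_Suc)
    have "min (Suc (Suc t)) (Suc n) \<le> fst (pass \<sigma> k js)"
    proof (cases "k \<le> n")
      case True
      with k have "k \<in> {1..n}" by auto
      then have "k \<in> \<sigma> ` {1..n}" using permutes_image[OF p] by simp
      then have "k \<in> \<sigma> ` set js" by (auto simp: js simp del: upt_Suc)
      from pass_fst_gt[OF this] k show ?thesis by simp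
    next
      case False
      with pass_fst_ge[of k \<sigma> js] show ?thesis by simp
    qed
    moreover have "snd (pass \<sigma> k js) = filter (\<lambda>i. fst (pass \<sigma> k js) \<le> \<sigma> i) [1..<n + 1]"
      using pass_fst_ge[of k \<sigma> js]
      by (subst s) (auto simp: js simp del: upt_Suc intro!: filter_cong)
    ultimately show ?case by (simp add: e del: upt_Suc)
  qed
qed

lemma passes_finished:
  assumes "\<sigma> \<in> Sym n" "n \<le> t" shows "snd (passes n \<sigma> t) = []"
proof -
  have p: "\<sigma> permutes {1..n}" using assms by (simp add: Sym_def)
  have "Suc n \<le> fst (passes n \<sigma> t)" using passes_invariant[OF assms(1), of t] assms(2) by simp
  moreover have "\<sigma> i \<le> n" if "i \<in> {1..n}" for i
    using permutes_in_image[OF p, of i] that by simp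
  ultimately have "filter (\<lambda>i. fst (passes n \<sigma> t) \<le> \<sigma> i) [1..<n + 1] = []"
    by (fastforce simp: filter_empty_conv simp del: upt_Suc)
  with passes_invariant[OF assms(1), of t] show ?thesis by simp
qed

end

theory Submission
  imports Defs
begin

text \<open>
  Both maps are involutions, so a statistic \<open>f\<close> is homomesic iff \<open>f \<sigma> + f (X \<sigma>)\<close> is constant.
  Reversing \<open>\<sigma>\<close> complements \<open>\<sigma>\<^sup>-\<^sup>1\<close>, which exchanges its descents and ascents; this settles the
  load, the inverse major index and the disorder, the latter being the sum of \<open>n - j\<close> over the
  descents \<open>j\<close> of \<open>\<sigma>\<^sup>-\<^sup>1\<close>. For the inversion index, each pair of values is inverted in exactly one
  of \<open>\<sigma>\<close> and its reverse. For the makl, the patterns occurring in \<open>\<sigma>\<close> or in its reverse merge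
  into all pairs of non-adjacent positions, each counted once. For the complement map, the
  permutations 123 and 132 already give different averages.
\<close>

section \<open>Homomesy of involutions\<close>

lemma orbit_involution:
  assumes "X (X x) = x"
  shows "orbit X x = {x, X x}"
proof
  show "orbit X x \<subseteq> {x, X x}"
  proof
    fix y assume "y \<in> orbit X x"
    then show "y \<in> {x, X x}" by induction (use assms in auto)
  qed
  \<comment> \<open>\<open>orbit X x\<close> is generated from \<open>X x\<close>, so
    \<open>x\<close> itself appears only after one further step.\<close>
  have "X x \<in> orbit X x" by (rule orbit.base)
  moreover from orbit.step[OF this] have "x \<in> orbit X x" by (simp add: assms)
  ultimately show "{x, X x} \<subseteq> orbit X x" by simp
qed

text \<open>Orbits of one and of two elements share a formula for the average: at a fixed point the
  single value \<open>f x\<close> equals \<open>(f x + f x) / 2\<close>.\<close>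

lemma homomesic_involution_iff:
  assumes "\<And>x. x \<in> S \<Longrightarrow> X (X x) = x"
  shows "homomesic S X f \<longleftrightarrow> (\<exists>c::real. \<forall>x\<in>S. real_of_int (f x + f (X x)) = c)"
proof -
  have avg: "(1 / real (card (orbit X x))) * (\<Sum>y\<in>orbit X x. real_of_int (f y))
      = real_of_int (f x + f (X x)) / 2"
    if "x \<in> S" for x
    using orbit_involution[of X x] assms[OF that] by (cases "X x = x") auto
  have "homomesic S X f \<longleftrightarrow> (\<exists>c::real. \<forall>x\<in>S. real_of_int (f x + f (X x)) / 2 = c)"
    unfolding homomesic_def using avg by (metis (no_types, lifting))
  also have "\<dots> \<longleftrightarrow> (\<exists>c::real. \<forall>x\<in>S. real_of_int (f x + f (X x)) = c)"
  proof
    assume "\<exists>c::real. \<forall>x\<in>S. real_of_int (f x + f (X x)) / 2 = c"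
    then obtain c :: real where "\<forall>x\<in>S. real_of_int (f x + f (X x)) / 2 = c" ..
    then have "\<forall>x\<in>S. real_of_int (f x + f (X x)) = 2 * c" by fastforce
    then show "\<exists>c::real. \<forall>x\<in>S. real_of_int (f x + f (X x)) = c" ..
  qed metis
  finally show ?thesis .
qed

section \<open>The reverse and complement maps on permutations\<close>

lemma reverse_map_reverse_map:
  assumes "\<sigma> \<in> Sym n" shows "reverse_map n (reverse_map n \<sigma>) = \<sigma>"
  using assms by (auto simp: Sym_def reverse_map_def fun_eq_iff permutes_def)

lemma Sym_apply_in: "\<sigma> \<in> Sym n \<Longrightarrow> 1 \<le> i \<Longrightarrow> i \<le> n \<Longrightarrow> 1 \<le> \<sigma> i \<and> \<sigma> i \<le> n"
  using permutes_in_image[of \<sigma> "{1..n}" i] by (simp add: Sym_def)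

lemma Sym_apply_outside: "\<sigma> \<in> Sym n \<Longrightarrow> i \<notin> {1..n} \<Longrightarrow> \<sigma> i = i"
  by (auto simp: Sym_def permutes_not_in)

lemma Sym_inj: "\<sigma> \<in> Sym n \<Longrightarrow> inj \<sigma>"
  by (auto simp: Sym_def dest: permutes_inj)

lemma Sym_inv: "\<sigma> \<in> Sym n \<Longrightarrow> inv \<sigma> \<in> Sym n"
  by (auto simp: Sym_def intro: permutes_inv)

lemma complement_map_complement_map:
  assumes "\<sigma> \<in> Sym n" shows "complement_map n (complement_map n \<sigma>) = \<sigma>"
proof
  fix i
  show "complement_map n (complement_map n \<sigma>) i = \<sigma> i"
    using Sym_apply_in[OF assms, of i] Sym_apply_outside[OF assms, of i]
    by (auto simp: complement_map_def)
qed

lemma homomesic_reverseI: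
  assumes "\<And>\<sigma>. \<sigma> \<in> Sym n \<Longrightarrow> f \<sigma> + f (reverse_map n \<sigma>) = c"
  shows "homomesic (Sym n) (reverse_map n) f"
  using assms by (subst homomesic_involution_iff) (auto simp: reverse_map_reverse_map)

lemma not_homomesic_complementI:
  assumes "\<sigma> \<in> Sym n" "\<tau> \<in> Sym n"
    and "f \<sigma> + f (complement_map n \<sigma>) \<noteq> f \<tau> + f (complement_map n \<tau>)"
  shows "\<not> homomesic (Sym n) (complement_map n) f"
  using assms
  by (subst homomesic_involution_iff)
     (auto simp: complement_map_complement_map, metis of_int_add of_int_eq_iff)

section \<open>Descents of the inverse permutation\<close>

text \<open>Reversal precomposes \<open>\<sigma>\<close> with the involution taking \<open>i\<close>
  to \<open>n + 1 - i\<close>; inverting moves this involution to the other side, where it acts as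
  complementation.\<close>

lemma inv_reverse_map:
  assumes "\<sigma> \<in> Sym n"
  shows "inv (reverse_map n \<sigma>) = complement_map n (inv \<sigma>)"
proof (rule inv_unique_comp)
  have p: "\<sigma> permutes {1..n}" using assms by (simp add: Sym_def)
  show "reverse_map n \<sigma> \<circ> complement_map n (inv \<sigma>) = id"
  proof
    fix i
    show "(reverse_map n \<sigma> \<circ> complement_map n (inv \<sigma>)) i = id i"
      using Sym_apply_in[OF Sym_inv[OF assms], of i] permutes_inverses(1)[OF p]
      by (auto simp: reverse_map_def complement_map_def)
  qed
  show "complement_map n (inv \<sigma>) \<circ> reverse_map n \<sigma> = id"
  proof
    fix i
    show "(complement_map n (inv \<sigma>) \<circ> reverse_map n \<sigma>) i = id i"
    proof (cases "i \<in> {1..n}")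
      case True
      then have "1 \<le> \<sigma> (n + 1 - i) \<and> \<sigma> (n + 1 - i) \<le> n" by (intro Sym_apply_in[OF assms]) auto
      then show ?thesis
        using True permutes_inverses(2)[OF p] by (auto simp: reverse_map_def complement_map_def)
    qed (auto simp: reverse_map_def complement_map_def)
  qed
qed

text \<open>Apply \<open>inv_reverse_map\<close> to \<open>inv \<sigma>\<close> and invert both
  sides.\<close>

lemma inv_complement_map:
  assumes "\<sigma> \<in> Sym n"
  shows "inv (complement_map n \<sigma>) = reverse_map n (inv \<sigma>)"
proof -
  have "inv (reverse_map n (inv \<sigma>)) = complement_map n \<sigma>"
    using inv_reverse_map[OF Sym_inv[OF assms]] assms
    by (simp add: Sym_def permutes_inv_inv)
  moreover have "reverse_map n (inv \<sigma>) permutes {1..n}"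
    using reverse_map_in_Sym[OF Sym_inv[OF assms]] by (simp add: Sym_def)
  ultimately show ?thesis using permutes_inv_inv by metis
qed

lemma reverse_complement_commute:
  "reverse_map n (complement_map n \<sigma>) = complement_map n (reverse_map n \<sigma>)"
  by (rule ext) (auto simp: reverse_map_def complement_map_def)

text \<open>Complementation flips every comparison of neighbours and so exchanges descents and
  ascents. The weight is arbitrary because the major index uses \<open>i\<close> and the disorder
  uses \<open>n - i\<close>.\<close>

lemma sum_descents_complement:
  assumes "\<pi> \<in> Sym n"
  shows "sum w (descents n \<pi>) + sum w (descents n (complement_map n \<pi>)) = sum w {1..<n}"
proof -
  have "complement_map n \<pi> (i + 1) < complement_map n \<pi> i \<longleftrightarrow> \<not> \<pi> (i + 1) < \<pi> i"
    if "1 \<le> i" "i < n" for i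
  proof -
    have "\<pi> i \<noteq> \<pi> (i + 1)" by (simp add: inj_eq[OF Sym_inj[OF assms]])
    \<comment> \<open>With these bounds the natural-number subtraction in
      \<open>complement_map\<close> is not truncated.\<close>
    moreover have "\<pi> i \<le> n" "\<pi> (i + 1) \<le> n" using Sym_apply_in[OF assms] that by simp_all
    ultimately show ?thesis using that by (simp add: complement_map_def) linarith
  qed
  then have "descents n (complement_map n \<pi>) = {1..<n} - descents n \<pi>"
    by (auto simp: descents_def)
  moreover have "descents n \<pi> \<subseteq> {1..<n}" by (auto simp: descents_def)
  ultimately show ?thesis
    using sum.subset_diff[of "descents n \<pi>" "{1..<n}" w] by (simp add: add.commute)
qed

lemma maj_eq_sum_descents: "maj n \<pi> = \<Sum>(descents n \<pi>)"
  by (simp add: maj_def descents_def)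

lemma inverse_maj_reverse:
  assumes "\<sigma> \<in> Sym n"
  shows "inverse_maj n \<sigma> + inverse_maj n (reverse_map n \<sigma>) = int (\<Sum>{1..<n})"
  using sum_descents_complement[OF Sym_inv[OF assms], of "\<lambda>i. i"]
  by (simp add: inverse_maj_def inv_reverse_map[OF assms] maj_eq_sum_descents
      del: of_nat_sum flip: of_nat_add)

text \<open>Since the two maps commute, the complement coming from \<open>inv_reverse_map\<close>
  can be pulled out of the reversal in \<open>load\<close>; the descent sums are then those of
  \<open>reverse_map n (inv \<sigma>)\<close> and its complement.\<close>

lemma load_reverse:
  assumes "\<sigma> \<in> Sym n"
  shows "load n \<sigma> + load n (reverse_map n \<sigma>) = int (\<Sum>{1..<n})"
  using sum_descents_complement[OF reverse_map_in_Sym[OF Sym_inv[OF assms]], of "\<lambda>i. i"]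
  by (simp add: load_def inv_reverse_map[OF assms] maj_eq_sum_descents reverse_complement_commute
      del: of_nat_sum flip: of_nat_add)

text \<open>Complementation exchanges the load and the inverse major index, so for either statistic
  the values at \<open>\<sigma>\<close> and its complement add up to
  \<open>load n \<sigma> + inverse_maj n \<sigma>\<close>.\<close>

lemma inverse_maj_complement:
  "\<sigma> \<in> Sym n \<Longrightarrow> inverse_maj n (complement_map n \<sigma>) = load n \<sigma>"
  by (simp add: inverse_maj_def load_def inv_complement_map)

lemma load_complement:
  "\<sigma> \<in> Sym n \<Longrightarrow> load n (complement_map n \<sigma>) = inverse_maj n \<sigma>"
  by (simp add: inverse_maj_def load_def inv_complement_map reverse_map_reverse_map Sym_inv)

section \<open>Disorder\<close>

text \<open>A pass removes each value to the right of the previous one, so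
  \<open>inv \<sigma>\<close> increases along the removed run. It stops at \<open>k'\<close> because
  that value, if still present, lies to the left of \<open>k' - 1\<close>. Hence a new pass begins
  exactly at a descent of \<open>inv \<sigma>\<close>. The induction is on the remaining positions,
  listed from left to right.\<close>

lemma pass_run:
  fixes k :: nat
  assumes "inj \<sigma>" "sorted_wrt (<) is"
  defines "k' \<equiv> fst (pass \<sigma> k is)"
  shows "{k..<k'} \<subseteq> \<sigma> ` set is
    \<and> (\<forall>u. k \<le> u \<and> u + 1 < k' \<longrightarrow> inv \<sigma> u < inv \<sigma> (u + 1))
    \<and> (k' \<in> \<sigma> ` set is \<longrightarrow> inv \<sigma> k' < inv \<sigma> (k' - 1))"
  using assms(2) unfolding k'_def
proof (induction "is" arbitrary: k)
  case (Cons i "is")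
  have later: "i < inv \<sigma> v" if "v \<in> \<sigma> ` set is" for v
    using that Cons.prems by (auto simp: inv_f_f[OF assms(1)])
  show ?case
  proof (cases "\<sigma> i = k")
    case True
    define m where "m = fst (pass \<sigma> (k + 1) is)"
    have m: "k + 1 \<le> m" unfolding m_def by (rule pass_fst_ge)
    have IH: "{k + 1..<m} \<subseteq> \<sigma> ` set is"
      "\<And>u. k + 1 \<le> u \<Longrightarrow> u + 1 < m \<Longrightarrow> inv \<sigma> u < inv \<sigma> (u + 1)"
      "m \<in> \<sigma> ` set is \<Longrightarrow> inv \<sigma> m < inv \<sigma> (m - 1)"
      using Cons.IH[of "k + 1"] Cons.prems by (auto simp: m_def)
    have ik: "inv \<sigma> k = i" using True inv_f_f[OF assms(1)] by auto
    have eq: "fst (pass \<sigma> k (i # is)) = m" using True by (simp add: m_def)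
    have "{k..<m} \<subseteq> \<sigma> ` set (i # is)"
    proof
      fix v assume "v \<in> {k..<m}"
      then show "v \<in> \<sigma> ` set (i # is)" using IH(1) True by (cases "v = k") auto
    qed
    moreover have "inv \<sigma> u < inv \<sigma> (u + 1)" if "k \<le> u" "u + 1 < m" for u
    proof (cases "u = k")
      case True
      then have "u + 1 \<in> \<sigma> ` set is" using IH(1) that by auto
      then show ?thesis using later True ik by simp
    next
      case False
      then show ?thesis using IH(2)[of u] that by simp
    qed
    \<comment> \<open>The head cannot carry \<open>m\<close>, since
      \<open>\<sigma> i = k < m\<close>.\<close>
    moreover have "inv \<sigma> m < inv \<sigma> (m - 1)" if "m \<in> \<sigma> ` set (i # is)"
      using that m True IH(3) by auto
    ultimately show ?thesis unfolding eq by blast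
  next
    case False
    define m where "m = fst (pass \<sigma> k is)"
    have IH: "{k..<m} \<subseteq> \<sigma> ` set is"
      "\<And>u. k \<le> u \<Longrightarrow> u + 1 < m \<Longrightarrow> inv \<sigma> u < inv \<sigma> (u + 1)"
      "m \<in> \<sigma> ` set is \<Longrightarrow> inv \<sigma> m < inv \<sigma> (m - 1)"
      using Cons.IH[of "k"] Cons.prems by (auto simp: m_def)
    have eq: "fst (pass \<sigma> k (i # is)) = m" using False by (simp add: m_def split_beta)
    \<comment> \<open>Here the skipped head carries \<open>m\<close>, while \<open>m - 1\<close> is
      removed from the tail and hence lies further right.\<close>
    have "inv \<sigma> m < inv \<sigma> (m - 1)" if "m = \<sigma> i"
    proof -
      have "k < m" using pass_fst_ge[of k \<sigma> "is"] False that by (auto simp: m_def)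
      then have "m - 1 \<in> \<sigma> ` set is" using IH(1) by auto
      then show ?thesis using later that inv_f_f[OF assms(1)] by auto
    qed
    then show ?thesis unfolding eq using IH by auto
  qed
qed simp

text \<open>
  The value \<open>v\<close> is removed in the pass numbered one more than the number of descents of
  \<open>\<sigma>\<^sup>-\<^sup>1\<close> below \<open>v\<close>.
\<close>
lemma fst_passes_le_iff:
  assumes "\<sigma> \<in> Sym n" "1 \<le> v" "v \<le> n"
  shows "fst (passes n \<sigma> t) \<le> v \<longleftrightarrow> t \<le> card {u \<in> descents n (inv \<sigma>). u < v}"
proof -
  define d where "d v = card {u \<in> descents n (inv \<sigma>). u < v}" for v
  define k where "k t = fst (passes n \<sigma> t)" for t
  have p: "\<sigma> permutes {1..n}" using assms by (simp add: Sym_def)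
  have inj: "inj \<sigma>" by (rule permutes_inj[OF p])
  have d_mono: "d a \<le> d b" if "a \<le> b" for a b
    unfolding d_def using that by (intro card_mono) (auto simp: descents_def)
  \<comment> \<open>As long as values remain, exactly \<open>t\<close> descents lie below the next
    needed value \<open>k t\<close>. The last clause concerns the value removed just before it and
    stays informative once \<open>k t\<close> exceeds \<open>n\<close>.\<close>
  have "1 \<le> k t \<and> (k t \<le> n \<longrightarrow> d (k t) = t) \<and> (t > 0 \<longrightarrow> d (k t - 1) < t)" for t
  proof (induction t)
    case 0
    show ?case by (simp add: k_def d_def descents_def)
  next
    case (Suc t)
    define js where "js = filter (\<lambda>i. k t \<le> \<sigma> i) [1..<n + 1]"
    have step: "k (Suc t) = fst (pass \<sigma> (k t) js)"
      using passes_invariant[OF assms(1), of t] by (simp add: k_def js_def split_beta del: upt_Suc)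
    have "sorted_wrt (<) js" unfolding js_def by (intro sorted_wrt_filter sorted_wrt_upt)
    note run = pass_run[OF inj this, of "k t", folded step]
    have ge: "k t \<le> k (Suc t)" unfolding step by (rule pass_fst_ge)
    have mem: "v \<in> \<sigma> ` set js" if "k t \<le> v" "v \<le> n" for v
    proof -
      have "v \<in> {1..n}" using that Suc.IH by auto
      then have "v \<in> \<sigma> ` {1..n}" using permutes_image[OF p] by simp
      then show ?thesis using that by (auto simp: js_def simp del: upt_Suc)
    qed
    show ?case
    proof (cases "k t \<le> n")
      case True
      have less: "k t < k (Suc t)" unfolding step by (rule pass_fst_gt[OF mem]) (use True in auto)
      \<comment> \<open>The values from \<open>k t\<close> to \<open>k (Suc t) - 1\<close> form one
        run, so there is no descent between consecutive ones.\<close>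
      have "{u \<in> descents n (inv \<sigma>). u < k (Suc t) - 1} = {u \<in> descents n (inv \<sigma>). u < k t}"
      proof -
        have "u < k t" if "u \<in> descents n (inv \<sigma>)" "u < k (Suc t) - 1" for u
        proof (rule ccontr)
          assume "\<not> u < k t"
          then have "inv \<sigma> u < inv \<sigma> (u + 1)" using run that(2) by auto
          then show False using that(1) by (simp add: descents_def)
        qed
        then show ?thesis using less by auto
      qed
      then have d1: "d (k (Suc t) - 1) = t" using Suc.IH True by (simp add: d_def)
      have "d (k (Suc t)) = Suc t" if "k (Suc t) \<le> n"
      proof -
        \<comment> \<open>The value that ends the pass lies left of its predecessor; this is the one
          new descent.\<close>
        have "inv \<sigma> (k (Suc t)) < inv \<sigma> (k (Suc t) - 1)" using run mem[OF ge that] by blast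
        then have "k (Suc t) - 1 \<in> descents n (inv \<sigma>)"
          using that less Suc.IH by (auto simp: descents_def)
        then have "{u \<in> descents n (inv \<sigma>). u < k (Suc t)}
            = insert (k (Suc t) - 1) {u \<in> descents n (inv \<sigma>). u < k (Suc t) - 1}"
          using less by auto
        then show ?thesis using d1 by (simp add: d_def descents_def)
      qed
      then show ?thesis using d1 less by simp
    next
      case False
      \<comment> \<open>All values are at most \<open>n < k t\<close>, so this pass removes
        nothing.\<close>
      have "fst (pass \<sigma> (k t) js) \<le> k t"
        by (rule pass_fst_le) (use False Sym_apply_in[OF assms(1)] in
            \<open>auto simp: js_def simp del: upt_Suc\<close>)
      then have eq: "k (Suc t) = k t" using ge step by simp
      have "d (k t - 1) < Suc t"
      proof (cases "t = 0")
        case True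
        then have "k t = 1" by (simp add: k_def)
        then show ?thesis by (simp add: d_def descents_def)
      next
        case False
        then show ?thesis using Suc.IH by simp
      qed
      then show ?thesis unfolding eq using False Suc.IH by simp
    qed
  qed
  note inv = this[of t]
  \<comment> \<open>Monotonicity of \<open>d\<close> gives \<open>t = d (k t) \<le> d v\<close> in
    one direction. In the other, \<open>v \<le> k t - 1\<close> would give \<open>d v < t\<close>;
    there \<open>t > 0\<close> because \<open>k 0 = 1 \<le> v\<close>.\<close>
  have "k t \<le> v \<longleftrightarrow> t \<le> d v"
  proof
    assume "k t \<le> v"
    then show "t \<le> d v" using inv d_mono[of "k t" v] assms(3) by simp
  next
    assume le: "t \<le> d v"
    show "k t \<le> v"
    proof (rule ccontr)
      assume "\<not> k t \<le> v"
      moreover from this have "t > 0" using assms(2) by (auto simp: k_def intro: gr0I)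
      moreover from calculation have "d v \<le> d (k t - 1)" by (intro d_mono) simp
      ultimately have "d v < t" using inv by simp
      then show False using le by simp
    qed
  qed
  then show ?thesis by (simp add: k_def d_def)
qed

text \<open>Position \<open>i\<close> survives one pass for each descent of
  \<open>inv \<sigma>\<close> below \<open>\<sigma> i\<close>. Double counting then gives the
  weight: a descent \<open>j\<close> is below the \<open>n - j\<close> values \<open>j + 1\<close>
  to \<open>n\<close>.\<close>

lemma disorder_eq_sum_descents:
  assumes "\<sigma> \<in> Sym n"
  shows "disorder n \<sigma> = int (\<Sum>j\<in>descents n (inv \<sigma>). n - j)"
proof -
  let ?D = "descents n (inv \<sigma>)"
  have p: "\<sigma> permutes {1..n}" using assms by (simp add: Sym_def)
  have fin: "finite ?D" by (simp add: descents_def)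
  have "card {t. t \<ge> 1 \<and> i \<in> set (snd (passes n \<sigma> t))} = card {u \<in> ?D. u < \<sigma> i}"
    if "i \<in> {1..n}" for i
  proof -
    have "i \<in> set (snd (passes n \<sigma> t)) \<longleftrightarrow> fst (passes n \<sigma> t) \<le> \<sigma> i" for t
      using passes_invariant[OF assms, of t] that by (auto simp del: upt_Suc)
    then have "{t. t \<ge> 1 \<and> i \<in> set (snd (passes n \<sigma> t))} = {1..card {u \<in> ?D. u < \<sigma> i}}"
      using fst_passes_le_iff[OF assms, of "\<sigma> i"] Sym_apply_in[OF assms, of i] that by auto
    then show ?thesis by simp
  qed
  then have "disorder n \<sigma> = int (\<Sum>i\<in>{1..n}. card {u \<in> ?D. u < \<sigma> i})"
    by (simp add: disorder_def)
  also have "(\<Sum>i\<in>{1..n}. card {u \<in> ?D. u < \<sigma> i}) = (\<Sum>v\<in>{1..n}. card {u \<in> ?D. u < v})"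
    using sum.permute[OF p, of "\<lambda>v. card {u \<in> ?D. u < v}"] by (simp add: comp_def)
  also have "\<dots> = (\<Sum>v\<in>{1..n}. \<Sum>u\<in>?D. if u < v then 1 else 0)"
    using fin by (simp add: sum.If_cases Int_def)
  also have "\<dots> = (\<Sum>u\<in>?D. \<Sum>v\<in>{1..n}. if u < v then 1 else 0)"
    by (rule sum.swap)
  also have "\<dots> = (\<Sum>u\<in>?D. n - u)"
  proof (rule sum.cong[OF refl])
    fix u assume "u \<in> ?D"
    have "{1..n} \<inter> {v. u < v} = {u<..n}" by auto
    then show "(\<Sum>v\<in>{1..n}. if u < v then 1 else 0) = n - u"
      by (simp add: sum.If_cases)
  qed
  finally show ?thesis .
qed

lemma disorder_reverse:
  assumes "\<sigma> \<in> Sym n"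
  shows "disorder n \<sigma> + disorder n (reverse_map n \<sigma>) = int (\<Sum>j\<in>{1..<n}. n - j)"
  using sum_descents_complement[OF Sym_inv[OF assms], of "\<lambda>j. n - j"]
  by (simp add: disorder_eq_sum_descents reverse_map_in_Sym assms inv_reverse_map
      del: of_nat_sum flip: of_nat_add)

section \<open>Inversion index\<close>

lemma inversion_index_reverse:
  assumes "\<sigma> \<in> Sym n"
  shows "inversion_index n \<sigma> + inversion_index n (reverse_map n \<sigma>)
    = int (\<Sum>(u, v) | u \<in> {1..n} \<and> v \<in> {1..n} \<and> v < u. u)"
proof -
  define A where "A = {(i, j). i \<in> {1..n} \<and> j \<in> {1..n} \<and> i < j \<and> \<sigma> i > \<sigma> j}"
  \<comment> \<open>In \<open>B\<close> the larger entry stands on the right: these are the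
    inversions of the reverse, with positions reflected back to \<open>\<sigma>\<close>. In both
    sets the first component locates the larger entry.\<close>
  define B where "B = {(i, j). i \<in> {1..n} \<and> j \<in> {1..n} \<and> j < i \<and> \<sigma> i > \<sigma> j}"
  have p: "\<sigma> permutes {1..n}" using assms by (simp add: Sym_def)
  have fin: "finite A" "finite B"
    by (auto intro: finite_subset[of _ "{1..n} \<times> {1..n}"] simp: A_def B_def)
  have "inversion_index n (reverse_map n \<sigma>) = int (\<Sum>(i, j)\<in>B. \<sigma> i)"
    unfolding inversion_index_def
    by (intro arg_cong[where f = int]
        sum.reindex_bij_witness[where i = "\<lambda>(i, j). (n + 1 - i, n + 1 - j)"
          and j = "\<lambda>(i, j). (n + 1 - i, n + 1 - j)"])
       (auto simp: B_def reverse_map_def)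
  moreover have "inversion_index n \<sigma> = int (\<Sum>(i, j)\<in>A. \<sigma> i)"
    by (simp add: inversion_index_def A_def)
  moreover have "(\<Sum>(i, j)\<in>A. \<sigma> i) + (\<Sum>(i, j)\<in>B. \<sigma> i) = (\<Sum>(i, j)\<in>A \<union> B. \<sigma> i)"
    by (rule sum.union_disjoint[symmetric]) (use fin in \<open>auto simp: A_def B_def\<close>)
  \<comment> \<open>In \<open>A \<union> B\<close> the order of the positions no longer matters, so
    pairs of positions can be replaced by the pairs of values they carry.\<close>
  moreover have "(\<Sum>(i, j)\<in>A \<union> B. \<sigma> i) = (\<Sum>(u, v) | u \<in> {1..n} \<and> v \<in> {1..n} \<and> v < u. u)"
  proof (rule sum.reindex_bij_witness[where j = "map_prod \<sigma> \<sigma>" and i = "map_prod (inv \<sigma>) (inv \<sigma>)"])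
    fix x assume "x \<in> {(u, v). u \<in> {1..n} \<and> v \<in> {1..n} \<and> v < u}"
    then obtain u v where x: "x = (u, v)" "u \<in> {1..n}" "v \<in> {1..n}" "v < u" by auto
    then have "inv \<sigma> u \<in> {1..n}" "inv \<sigma> v \<in> {1..n}"
      using Sym_apply_in[OF Sym_inv[OF assms]] by auto
    moreover have "inv \<sigma> u \<noteq> inv \<sigma> v"
      using x(4) permutes_inverses(1)[OF p] by (metis less_irrefl)
    ultimately show "map_prod (inv \<sigma>) (inv \<sigma>) x \<in> A \<union> B"
      using x permutes_inverses(1)[OF p] by (auto simp: A_def B_def)
  qed (use Sym_apply_in[OF assms] permutes_inverses[OF p] in \<open>auto simp: A_def B_def\<close>)
  ultimately show ?thesis by (simp del: of_nat_sum flip: of_nat_add)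
qed

section \<open>Makl\<close>

lemma same_relative_order_132: "same_relative_order [x, y, z] [1, 3, 2] \<longleftrightarrow> x < z \<and> z < y"
  and same_relative_order_312: "same_relative_order [x, y, z] [3, 1, 2] \<longleftrightarrow> y < z \<and> z < x"
  and same_relative_order_321: "same_relative_order [x, y, z] [3, 2, 1] \<longleftrightarrow> z < y \<and> y < x"
  by (auto simp: same_relative_order_def All_less_Suc numeral_3_eq_3)

text \<open>The simplified copies match goals in which \<open>1\<close> has already become
  \<open>Suc 0\<close>.\<close>

lemmas same_relative_order_simps =
  same_relative_order_132 same_relative_order_312 same_relative_order_321
  same_relative_order_132[simplified] same_relative_order_312[simplified]
  same_relative_order_321[simplified]

text \<open>These are the outer positions of pattern occurrences: adjacency determines the middle
  position as \<open>b - 1\<close> or \<open>a + 1\<close>, and the gap leaves room for it.\<close>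

definition distant_pairs :: "nat \<Rightarrow> (nat \<times> nat) set" where
  "distant_pairs n = {(a, b). 1 \<le> a \<and> a + 2 \<le> b \<and> b \<le> n}"

lemma finite_distant_pairs: "finite (distant_pairs n)"
  by (rule finite_subset[of _ "{1..n} \<times> {1..n}"]) (auto simp: distant_pairs_def)

lemma card_occ_132:
  "card (occ_1_23 n \<sigma> 1 3 2) = card {(a, b) \<in> distant_pairs n. \<sigma> a < \<sigma> b \<and> \<sigma> b < \<sigma> (b - 1)}"
  by (intro bij_betw_same_card[of "\<lambda>(i, j, k). (i, k)"]
      bij_betw_byWitness[where f' = "\<lambda>(a, b). (a, b - 1, b)"])
     (auto simp: occ_1_23_def distant_pairs_def same_relative_order_simps)

text \<open>The two patterns differ only in the order of the last two entries, so together they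
  leave that order free; injectivity excludes a tie.\<close>

lemma card_occ_312_321:
  assumes "inj \<sigma>"
  shows "card (occ_12_3 n \<sigma> 3 1 2) + card (occ_12_3 n \<sigma> 3 2 1)
    = card {(a, b) \<in> distant_pairs n. \<sigma> (a + 1) < \<sigma> a \<and> \<sigma> b < \<sigma> a}"
proof -
  have fin: "finite (occ_12_3 n \<sigma> a b c)" for a b c
    by (rule finite_subset[of _ "{1..n} \<times> {1..n} \<times> {1..n}"]) (auto simp: occ_12_3_def)
  have "card (occ_12_3 n \<sigma> 3 1 2) + card (occ_12_3 n \<sigma> 3 2 1)
      = card (occ_12_3 n \<sigma> 3 1 2 \<union> occ_12_3 n \<sigma> 3 2 1)"
    by (rule card_Un_disjoint[symmetric, OF fin fin])
       (auto simp: occ_12_3_def same_relative_order_simps)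
  also have "\<dots> = card {(a, b) \<in> distant_pairs n. \<sigma> (a + 1) < \<sigma> a \<and> \<sigma> b < \<sigma> a}"
  proof (intro bij_betw_same_card[of "\<lambda>(i, j, k). (i, k)"]
      bij_betw_byWitness[where f' = "\<lambda>(a, b). (a, a + 1, b)"])
    have "\<sigma> (a + 1) \<noteq> \<sigma> b" if "a + 2 \<le> b" for a b
      using that by (simp add: inj_eq[OF assms])
    then show "(\<lambda>(a, b). (a, a + 1, b)) `
        {(a, b) \<in> distant_pairs n. \<sigma> (a + 1) < \<sigma> a \<and> \<sigma> b < \<sigma> a}
        \<subseteq> occ_12_3 n \<sigma> 3 1 2 \<union> occ_12_3 n \<sigma> 3 2 1"
      by (fastforce simp: occ_12_3_def distant_pairs_def same_relative_order_simps)
  qed (auto simp: occ_12_3_def distant_pairs_def same_relative_order_simps)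
  finally show ?thesis .
qed

lemma makl_eq_card_pairs:
  assumes "\<sigma> \<in> Sym n"
  shows "makl n \<sigma> = int (card {(a, b) \<in> distant_pairs n. \<sigma> a < \<sigma> b \<and> \<sigma> b < \<sigma> (b - 1)}
    + card {(a, b) \<in> distant_pairs n. \<sigma> (a + 1) < \<sigma> a \<and> \<sigma> b < \<sigma> a} + card (descents n \<sigma>))"
  unfolding makl_def card_occ_132 card_occ_312_321[OF Sym_inj[OF assms], symmetric] by simp

text \<open>Reflecting positions swaps the roles of left and right; this translates pattern
  conditions on the reverse into conditions on \<open>\<sigma>\<close>.\<close>

lemma card_distant_pairs_flip:
  assumes "\<And>a b. (a, b) \<in> distant_pairs n \<Longrightarrow> P a b \<longleftrightarrow> Q (n + 1 - b) (n + 1 - a)"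
  shows "card {(a, b) \<in> distant_pairs n. P a b} = card {(a, b) \<in> distant_pairs n. Q a b}"
proof (intro bij_betw_same_card[of "\<lambda>(a, b). (n + 1 - b, n + 1 - a)"]
    bij_betw_byWitness[where f' = "\<lambda>(a, b). (n + 1 - b, n + 1 - a)"])
  have flip: "(n + 1 - b, n + 1 - a) \<in> distant_pairs n" "n + 1 - (n + 1 - a) = a" "n + 1 - (n + 1 - b) = b"
    if "(a, b) \<in> distant_pairs n" for a b
    using that by (auto simp: distant_pairs_def)
  show "(\<lambda>(a, b). (n + 1 - b, n + 1 - a)) ` {(a, b) \<in> distant_pairs n. P a b}
      \<subseteq> {(a, b) \<in> distant_pairs n. Q a b}"
    using flip(1) assms by auto
  show "(\<lambda>(a, b). (n + 1 - b, n + 1 - a)) ` {(a, b) \<in> distant_pairs n. Q a b}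
      \<subseteq> {(a, b) \<in> distant_pairs n. P a b}"
    using flip assms[OF flip(1)] by auto
qed (auto simp: distant_pairs_def)

text \<open>Reflection sends the neighbours \<open>i\<close> and \<open>i + 1\<close> to
  \<open>n + 1 - i\<close> and \<open>n - i\<close>, so a descent at \<open>i\<close> becomes an
  ascent at \<open>n - i\<close>.\<close>

lemma card_descents_reverse:
  assumes "\<sigma> \<in> Sym n"
  shows "card (descents n \<sigma>) + card (descents n (reverse_map n \<sigma>)) = n - 1"
proof -
  have ne: "\<sigma> i \<noteq> \<sigma> (Suc i)" for i by (simp add: inj_eq[OF Sym_inj[OF assms]])
  have "card (descents n (reverse_map n \<sigma>)) = card ({1..<n} - descents n \<sigma>)"
  proof (intro bij_betw_same_card[of "\<lambda>i. n - i"] bij_betw_byWitness[where f' = "\<lambda>i. n - i"])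
    show "(\<lambda>i. n - i) ` descents n (reverse_map n \<sigma>) \<subseteq> {1..<n} - descents n \<sigma>"
      by (auto simp: descents_def reverse_map_def Suc_diff_le)
    show "(\<lambda>i. n - i) ` ({1..<n} - descents n \<sigma>) \<subseteq> descents n (reverse_map n \<sigma>)"
    proof clarify
      fix i assume i: "i \<in> {1..<n}" "i \<notin> descents n \<sigma>"
      then have "\<sigma> i < \<sigma> (Suc i)" using ne[of i] by (simp add: descents_def)
      then show "n - i \<in> descents n (reverse_map n \<sigma>)"
        using i(1) by (auto simp: descents_def reverse_map_def)
    qed
  qed (auto simp: descents_def)
  moreover have "descents n \<sigma> \<subseteq> {1..<n}" by (auto simp: descents_def)
  ultimately show ?thesis
    using card_mono[of "{1..<n}" "descents n \<sigma>"]
    by (simp add: card_Diff_subset finite_subset[of "descents n \<sigma>"])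
qed

lemma makl_reverse:
  assumes "\<sigma> \<in> Sym n"
  shows "makl n \<sigma> + makl n (reverse_map n \<sigma>) = int (card (distant_pairs n) + (n - 1))"
proof -
  let ?C = "\<lambda>P. {(a, b) \<in> distant_pairs n. P a b}"
  \<comment> \<open>\<open>A\<close> and \<open>B\<close> describe the patterns in
    \<open>\<sigma>\<close>; \<open>A'\<close> and \<open>B'\<close> are the same conditions on the
    reverse, reflected back to \<open>\<sigma>\<close>.\<close>
  define A where "A = ?C (\<lambda>a b. \<sigma> a < \<sigma> b \<and> \<sigma> b < \<sigma> (b - 1))"
  define B where "B = ?C (\<lambda>a b. \<sigma> (a + 1) < \<sigma> a \<and> \<sigma> b < \<sigma> a)"
  define A' where "A' = ?C (\<lambda>a b. \<sigma> b < \<sigma> a \<and> \<sigma> a < \<sigma> (a + 1))"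
  define B' where "B' = ?C (\<lambda>a b. \<sigma> (b - 1) < \<sigma> b \<and> \<sigma> a < \<sigma> b)"
  note defs = A_def B_def A'_def B'_def
  have sub: "A \<subseteq> distant_pairs n" "B \<subseteq> distant_pairs n" "A' \<subseteq> distant_pairs n" "B' \<subseteq> distant_pairs n"
    by (auto simp: defs)
  note fin = sub[THEN finite_subset, OF finite_distant_pairs]
  have ne: "\<sigma> a \<noteq> \<sigma> b" if "a \<noteq> b" for a b using that by (simp add: inj_eq[OF Sym_inj[OF assms]])
  have "card (?C (\<lambda>a b. reverse_map n \<sigma> a < reverse_map n \<sigma> b
      \<and> reverse_map n \<sigma> b < reverse_map n \<sigma> (b - 1))) = card A'"
    unfolding A'_def
    by (rule card_distant_pairs_flip) (auto simp: distant_pairs_def reverse_map_def Suc_diff_le)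
  moreover have "card (?C (\<lambda>a b. reverse_map n \<sigma> (a + 1) < reverse_map n \<sigma> a
      \<and> reverse_map n \<sigma> b < reverse_map n \<sigma> a)) = card B'"
    unfolding B'_def
    by (rule card_distant_pairs_flip) (auto simp: distant_pairs_def reverse_map_def Suc_diff_le)
  \<comment> \<open>\<open>A\<close> and \<open>B'\<close> split the pairs with
    \<open>\<sigma> a < \<sigma> b\<close> by comparing \<open>\<sigma> b\<close> with its left
    neighbour. Below, \<open>B\<close> and \<open>A'\<close> split the remaining pairs by comparing
    \<open>\<sigma> a\<close> with its right neighbour.\<close>
  moreover have "card A + card B' = card (A \<union> B')"
    by (rule card_Un_disjoint[symmetric]) (use fin in \<open>auto simp: A_def B'_def\<close>)
  moreover have "A \<union> B' = ?C (\<lambda>a b. \<sigma> a < \<sigma> b)"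
  proof -
    have "\<sigma> b < \<sigma> (b - 1) \<or> \<sigma> (b - 1) < \<sigma> b" if "(a, b) \<in> distant_pairs n" for a b
    proof -
      have "b \<noteq> b - 1" using that by (auto simp: distant_pairs_def)
      then show ?thesis using ne linorder_neqE_nat by blast
    qed
    then show ?thesis by (auto simp: A_def B'_def)
  qed
  moreover have "card B + card A' = card (B \<union> A')"
    by (rule card_Un_disjoint[symmetric]) (use fin in \<open>auto simp: A'_def B_def\<close>)
  moreover have "B \<union> A' = ?C (\<lambda>a b. \<sigma> b < \<sigma> a)"
  proof -
    have "\<sigma> a < \<sigma> (a + 1) \<or> \<sigma> (a + 1) < \<sigma> a" for a
      using ne[of a "a + 1"] by auto
    then show ?thesis by (auto simp: A'_def B_def)
  qed
  moreover have "card (?C (\<lambda>a b. \<sigma> a < \<sigma> b)) + card (?C (\<lambda>a b. \<sigma> b < \<sigma> a)) = card (distant_pairs n)"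
  proof -
    have "distant_pairs n = ?C (\<lambda>a b. \<sigma> a < \<sigma> b) \<union> ?C (\<lambda>a b. \<sigma> b < \<sigma> a)"
    proof -
      have "\<sigma> a < \<sigma> b \<or> \<sigma> b < \<sigma> a" if "(a, b) \<in> distant_pairs n" for a b
        using ne[of a b] that by (auto simp: distant_pairs_def)
      then show ?thesis by auto
    qed
    moreover have "card (?C (\<lambda>a b. \<sigma> a < \<sigma> b) \<union> ?C (\<lambda>a b. \<sigma> b < \<sigma> a))
        = card (?C (\<lambda>a b. \<sigma> a < \<sigma> b)) + card (?C (\<lambda>a b. \<sigma> b < \<sigma> a))"
      by (rule card_Un_disjoint) (auto intro: finite_subset[OF _ finite_distant_pairs[of n]])
    ultimately show ?thesis by simp
  qed
  moreover have "makl n \<sigma> = int (card A + card B + card (descents n \<sigma>))"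
    unfolding A_def B_def by (rule makl_eq_card_pairs[OF assms])
  moreover note makl_eq_card_pairs[OF reverse_map_in_Sym[OF assms]] card_descents_reverse[OF assms]
  ultimately show ?thesis by (simp only: of_nat_add)
qed

section \<open>Failure for the complement map\<close>

lemma descents_3:
  "descents 3 \<pi> = (if \<pi> 1 > \<pi> 2 then {1} else {}) \<union> (if \<pi> 2 > \<pi> 3 then {2} else {})"
proof -
  have "{1..<3} = {1, 2 :: nat}" by auto
  then show ?thesis by (auto simp: descents_def numeral_2_eq_2 numeral_3_eq_3)
qed

lemma inversion_index_3:
  "inversion_index 3 \<sigma> = int ((if \<sigma> 1 > \<sigma> 2 then \<sigma> 1 else 0) + (if \<sigma> 1 > \<sigma> 3 then \<sigma> 1 else 0)
    + (if \<sigma> 2 > \<sigma> 3 then \<sigma> 2 else 0))"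
proof -
  have three: "{1..3} = {1, 2, 3 :: nat}" by auto
  have "{(i, j). i \<in> {1..3} \<and> j \<in> {1..3} \<and> i < j \<and> \<sigma> i > \<sigma> j}
    = {x \<in> {(1, 2), (1, 3), (2, 3)}. case x of (i, j) \<Rightarrow> \<sigma> i > \<sigma> j}"
    unfolding three by auto
  also have "(\<Sum>(i, j)\<in>\<dots>. \<sigma> i)
    = (\<Sum>x\<in>{(1, 2), (1, 3), (2, 3)}. if case x of (i, j) \<Rightarrow> \<sigma> i > \<sigma> j then case x of (i, j) \<Rightarrow> \<sigma> i else 0)"
    by (rule sum.inter_filter) simp
  finally show ?thesis by (simp add: inversion_index_def)
qed

text \<open>The only triple is \<open>(1, 2, 3)\<close>, which meets either adjacency condition, so
  both kinds of vincular pattern coincide.\<close>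

lemma occ_3:
  "occ_1_23 3 \<sigma> a b c = (if same_relative_order [\<sigma> 1, \<sigma> 2, \<sigma> 3] [a, b, c] then {(1, 2, 3)} else {})"
  "occ_12_3 3 \<sigma> a b c = (if same_relative_order [\<sigma> 1, \<sigma> 2, \<sigma> 3] [a, b, c] then {(1, 2, 3)} else {})"
proof -
  have pos: "1 \<le> i \<and> i < j \<and> j < k \<and> k \<le> 3 \<and> P \<longleftrightarrow> i = 1 \<and> j = 2 \<and> k = 3 \<and> P" for i j k :: nat and P
    by auto
  show "occ_1_23 3 \<sigma> a b c = (if same_relative_order [\<sigma> 1, \<sigma> 2, \<sigma> 3] [a, b, c] then {(1, 2, 3)} else {})"
    "occ_12_3 3 \<sigma> a b c = (if same_relative_order [\<sigma> 1, \<sigma> 2, \<sigma> 3] [a, b, c] then {(1, 2, 3)} else {})"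
    unfolding occ_1_23_def occ_12_3_def pos by (auto simp: numeral_2_eq_2 numeral_3_eq_3)
qed

theorem theorem5p6:
  shows "\<forall>stat \<in> {load, inverse_maj, disorder, inversion_index, makl}.
    (\<forall>n>0. homomesic (Sym n) (reverse_map n) (stat n)) \<and>
    (\<exists>n>0. \<not> homomesic (Sym n) (complement_map n) (stat n))"
proof (intro ballI conjI allI impI)
  fix stat :: "nat \<Rightarrow> (nat \<Rightarrow> nat) \<Rightarrow> int" and n :: nat
  assume "stat \<in> {load, inverse_maj, disorder, inversion_index, makl}"
  then show "homomesic (Sym n) (reverse_map n) (stat n)"
    by (auto intro: homomesic_reverseI load_reverse inverse_maj_reverse disorder_reverse
        inversion_index_reverse makl_reverse)
next
  fix stat :: "nat \<Rightarrow> (nat \<Rightarrow> nat) \<Rightarrow> int"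
  assume stat: "stat \<in> {load, inverse_maj, disorder, inversion_index, makl}"
  define \<tau> :: "nat \<Rightarrow> nat" where "\<tau> = transpose 2 3"
  have id: "id \<in> Sym 3" by (simp add: Sym_def permutes_id)
  have \<tau>: "\<tau> \<in> Sym 3" by (auto simp: Sym_def \<tau>_def intro: permutes_swap_id)
  have inv: "inv \<tau> = \<tau>" by (simp add: \<tau>_def)
  have vals: "\<tau> 1 = 1" "\<tau> (Suc 0) = 1" "\<tau> 2 = 3" "\<tau> 3 = 2" by (auto simp: \<tau>_def transpose_def)
  have maps: "reverse_map 3 \<pi> 1 = \<pi> 3" "reverse_map 3 \<pi> (Suc 0) = \<pi> 3"
    "reverse_map 3 \<pi> 2 = \<pi> 2" "reverse_map 3 \<pi> 3 = \<pi> 1"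
    "complement_map 3 \<pi> 1 = 4 - \<pi> 1" "complement_map 3 \<pi> (Suc 0) = 4 - \<pi> 1"
    "complement_map 3 \<pi> 2 = 4 - \<pi> 2" "complement_map 3 \<pi> 3 = 4 - \<pi> 3" for \<pi>
    by (simp_all add: reverse_map_def complement_map_def)
  \<comment> \<open>The orbits are 123 with 321 and 132 with 312. Their sums are 3 and 4 for the
    load, the inverse major index and the makl, 3 and 2 for the disorder, and 8 and 9 for the
    inversion index.\<close>
  have "stat 3 id + stat 3 (complement_map 3 id) \<noteq> stat 3 \<tau> + stat 3 (complement_map 3 \<tau>)"
    using stat
    by (auto simp: load_complement inverse_maj_complement id \<tau> load_def inverse_maj_def
        disorder_eq_sum_descents complement_map_in_Sym inv_complement_map inv vals
        maj_eq_sum_descents descents_3 inversion_index_3 makl_def occ_3 same_relative_order_simps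
        maps)
  then have "\<not> homomesic (Sym 3) (complement_map 3) (stat 3)"
    by (rule not_homomesic_complementI[OF id \<tau>])
  then show "\<exists>n>0. \<not> homomesic (Sym n) (complement_map n) (stat n)"
    by (intro exI[of _ 3]) simp
qed

end
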